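(* Let $r$ be a complex number with $r\notin\{-\tfrac12,-\tfrac22,-\tfrac32,\ldots\}$ and let $n\ge 0$ be an integer. Then, as polynomials in $x$, $$d_{n}^{(r)}(x)^2=\binom{n+2r}{n}\sum_{m=0}^n\frac{\binom{x-r}{m}\binom{x+r+m}{m}\binom{n+2r+m}{n-m}}{\binom{m+2r}{m}}4^m.$$
   Context: For a complex number (or polynomial) $a$ and an integer $k\ge0$, $\binom{a}{k}=a(a-1)\cdots(a-k+1)/k!$, and $\binom{a}{k}=0$ for $k<0$. For a parameter $r$ and an integer $n\ge 0$, define the polynomial $d_n^{(r)}(x)=\sum_{k=0}^n\binom{x+r+k}{k}\binom{x-r}{n-k}$. *)

theory Defs
  imports Complex_Main "HOL-Computational_Algebra.Polynomial"
begin

text \<open>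
  The binomial coefficient \<open>p (p - 1) \<dots> (p - k + 1) / k!\<close> of a polynomial. The library's
  \<^const>\<open>gbinomial\<close> is constrained to fields of characteristic zero, so it does not apply to
  polynomials; the two agree pointwise by \<open>poly_pbinomial\<close> below.
\<close>

definition pbinomial :: "complex poly \<Rightarrow> nat \<Rightarrow> complex poly"  (infix \<open>pchoose\<close> 64) where
  "p pchoose k = smult (1 / fact k) (\<Prod>i=0..<k. p - of_nat i)"

lemma poly_pbinomial: "poly (p pchoose k) x = poly p x gchoose k"
  by (simp add: pbinomial_def gbinomial_prod_rev poly_prod of_nat_poly)

text \<open>
  The indeterminate \<open>x\<close> is \<open>[:0, 1:]\<close>, and a scalar \<open>r\<close> is embedded as the constant
  polynomial \<open>[:r:]\<close>.
\<close>

definition d_poly :: "complex \<Rightarrow> nat \<Rightarrow> complex poly" where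
  "d_poly r n =
     (\<Sum>k=0..n. (([:0, 1:] + [:r:] + of_nat k) pchoose k) * (([:0, 1:] - [:r:]) pchoose (n - k)))"

end

theory Submission
  imports Defs "HOL-Computational_Algebra.Formal_Power_Series"
begin

text \<open>
  The generating function of \<open>d\<^sub>n\<close> is \<open>(1 + z)\<^bsup>x - r\<^esup> (1 - z)\<^bsup>- (x + r + 1)\<^esup>\<close>. Its logarithmic
  derivative gives \<open>(n + 1) d\<^sub>n\<^sub>+\<^sub>1 = y d\<^sub>n + (n + s) d\<^sub>n\<^sub>-\<^sub>1\<close> with \<open>y = 2 x + 1\<close> and \<open>s = 2 r\<close>.
  Hence \<open>S\<^sub>n = d\<^sub>n\<^sup>2\<close> and \<open>V\<^sub>n = (n + s) y d\<^sub>n d\<^sub>n\<^sub>-\<^sub>1\<close> satisfy the linear system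
  \<open>(n + 1)\<^sup>2 S\<^sub>n\<^sub>+\<^sub>1 = y\<^sup>2 S\<^sub>n + 2 V\<^sub>n + (n + s)\<^sup>2 S\<^sub>n\<^sub>-\<^sub>1\<close>,
  \<open>(n + 1) V\<^sub>n\<^sub>+\<^sub>1 = (n + 1 + s) (y\<^sup>2 S\<^sub>n + V\<^sub>n)\<close>,
  in which only \<open>y\<^sup>2\<close> occurs. Multiplication by \<open>y\<^sup>2\<close> is bidiagonal on the basis
  \<open>A\<^sub>m = 4\<^sup>m (x - r choose m) (x + r + m choose m)\<close>, and the coefficients of both \<open>S\<^sub>n\<close> and \<open>V\<^sub>n\<close> in this
  basis are hypergeometric terms, so the system can be verified coefficientwise.
\<close>

section \<open>Values of d_n at a point and their three-term recurrence\<close>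

definition dval :: "complex \<Rightarrow> complex \<Rightarrow> nat \<Rightarrow> complex" where
  "dval r x n = (\<Sum>k=0..n. ((x + r + of_nat k) gchoose k) * ((x - r) gchoose (n - k)))"

lemma poly_d_poly: "poly (d_poly r n) x = dval r x n"
  by (simp add: d_poly_def dval_def poly_sum poly_pbinomial of_nat_poly algebra_simps)

lemma dval_0: "dval r x 0 = 1"
  by (simp add: dval_def)

lemma dval_1: "dval r x (Suc 0) = 2 * x + 1"
  by (simp add: dval_def)

lemma Suc_gbinomial_Suc:
  "of_nat (Suc k) * ((a::complex) gchoose Suc k) = (a - of_nat k) * (a gchoose k)"
  using gbinomial_mult_1[of a k] by (simp add: algebra_simps)

lemma Suc_gbinomial_shift_Suc:
  "of_nat (Suc k) * ((a + of_nat (Suc k)) gchoose Suc k)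
     = (a + 1 + of_nat k) * (((a::complex) + of_nat k) gchoose k)"
proof -
  have "((a + of_nat k + 1) gchoose Suc k)
      = ((a + of_nat k) gchoose k) * ((a + of_nat k + 1) / of_nat (Suc k))"
    by (rule gbinomial_rec)
  then show ?thesis
    by (simp add: field_simps del: of_nat_Suc) (simp add: algebra_simps)
qed

lemma dval_rec:
  "of_nat (n + 2) * dval r x (n + 2)
     = (2 * x + 1) * dval r x (n + 1) + (of_nat n + 1 + 2 * r) * dval r x n"
proof -
  \<comment> \<open>\<open>E\<close> is (1 - z)^(-(x + r + 1)) and \<open>F\<close> is (1 + z)^(x -
    r), both given by their coefficients. The ratios of consecutive coefficients amount to the
    first-order differential equations \<open>dE\<close> and \<open>dF\<close>.\<close>
  define E where "E = Abs_fps (\<lambda>k. (x + r + of_nat k) gchoose k)"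
  define F where "F = Abs_fps (\<lambda>k. (x - r) gchoose k)"
  define D where "D = E * F"
  have dE: "(1 - fps_X) * fps_deriv E = fps_const (x + r + 1) * E"
  proof (rule fps_ext)
    fix k
    show "fps_nth ((1 - fps_X) * fps_deriv E) k = fps_nth (fps_const (x + r + 1) * E) k"
      using Suc_gbinomial_shift_Suc[of k "x + r"]
      by (cases k) (simp_all add: E_def left_diff_distrib algebra_simps del: gbinomial_Suc)
  qed
  have dF: "(1 + fps_X) * fps_deriv F = fps_const (x - r) * F"
  proof (rule fps_ext)
    fix k
    show "fps_nth ((1 + fps_X) * fps_deriv F) k = fps_nth (fps_const (x - r) * F) k"
      using Suc_gbinomial_Suc[of k "x - r"]
      by (cases k) (simp_all add: F_def distrib_right algebra_simps del: gbinomial_Suc)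
  qed
  have "(1 - fps_X * fps_X) * fps_deriv D
      = (1 + fps_X) * F * ((1 - fps_X) * fps_deriv E) + (1 - fps_X) * E * ((1 + fps_X) * fps_deriv F)"
    by (simp add: D_def algebra_simps)
  also have "\<dots> = ((1 + fps_X) * fps_const (x + r + 1) + (1 - fps_X) * fps_const (x - r)) * D"
    unfolding dE dF by (simp add: D_def algebra_simps)
  also have "(1 + fps_X) * fps_const (x + r + 1) + (1 - fps_X) * fps_const (x - r)
      = fps_const (2 * x + 1) + fps_X * fps_const (2 * r + 1)"
    by (rule fps_ext) (simp add: algebra_simps)
  finally have dD: "fps_deriv D - fps_X * (fps_X * fps_deriv D)
      = fps_const (2 * x + 1) * D + fps_X * (fps_const (2 * r + 1) * D)"
    by (simp add: algebra_simps)
  have Dn: "fps_nth D k = dval r x k" for k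
    by (simp add: D_def fps_mult_nth E_def F_def dval_def)
  \<comment> \<open>At z^(n+1) the left side is (n + 2) d_(n+2) - n d_n; moving n d_n to the right
    turns 2 r + 1 into n + 1 + 2 r.\<close>
  from dD have "fps_nth (fps_deriv D - fps_X * (fps_X * fps_deriv D)) (Suc n)
      = fps_nth (fps_const (2 * x + 1) * D + fps_X * (fps_const (2 * r + 1) * D)) (Suc n)"
    by simp
  then show ?thesis
    by (cases n; simp add: Dn; simp add: algebra_simps)
qed

section \<open>The basis A_m and multiplication by y^2\<close>

definition bas :: "complex \<Rightarrow> complex \<Rightarrow> nat \<Rightarrow> complex" where
  "bas r x m = 4 ^ m * ((x - r) gchoose m) * ((x + r + of_nat m) gchoose m)"

text \<open>Passing from A_m to A_(m+1) multiplies by 4 (x - r - m) (x + r + 1 + m) / (m + 1)^2,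
  whose numerator is the difference of the squares of 2 x + 1 and 2 r + 2 m + 1.\<close>

lemma bas_rec:
  "(2 * x + 1)\<^sup>2 * bas r x m
     = (2 * r + 2 * of_nat m + 1)\<^sup>2 * bas r x m + (of_nat (Suc m))\<^sup>2 * bas r x (Suc m)"
proof -
  have "(of_nat (Suc m))\<^sup>2 * bas r x (Suc m)
      = 4 * 4 ^ m * (of_nat (Suc m) * ((x - r) gchoose Suc m))
        * (of_nat (Suc m) * ((x + r + of_nat (Suc m)) gchoose Suc m))"
    by (simp only: bas_def power2_eq_square power_Suc mult_ac)
  also have "\<dots> = 4 * (x - r - of_nat m) * (x + r + 1 + of_nat m) * bas r x m"
    unfolding Suc_gbinomial_Suc[of m "x - r"] Suc_gbinomial_shift_Suc by (simp only: bas_def mult_ac)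
  finally show ?thesis
    by (simp only:) (simp add: power2_eq_square algebra_simps)
qed

section \<open>Coefficients of S_n and V_n in the basis, and their recurrences\<close>

definition scoef :: "complex \<Rightarrow> nat \<Rightarrow> nat \<Rightarrow> complex" where
  "scoef s n m = (if m \<le> n then
     pochhammer (s + 1) n / fact n * fact m / pochhammer (s + 1) m *
     (pochhammer (2 * of_nat m + s + 1) (n - m) / fact (n - m)) else 0)"

text \<open>For n \<ge> 1 this value is forced by solving the recurrence for S_(n+1) for
  V_n.\<close>

definition vcoef :: "complex \<Rightarrow> nat \<Rightarrow> nat \<Rightarrow> complex" where
  "vcoef s n m = scoef s n m * (of_nat n - of_nat m +
     of_nat n * (of_nat n + s) * (2 * of_nat m + s) / (of_nat n + of_nat m + s))"

lemma scoef_eq_0: "n < m \<Longrightarrow> scoef s n m = 0"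
  by (simp add: scoef_def)

context
  fixes s :: complex
  assumes s_not_neg: "\<And>k. k \<ge> 1 \<Longrightarrow> s + of_nat k \<noteq> 0"
begin

lemma pochhammer_nz: "pochhammer (s + 1) n \<noteq> 0"
proof
  assume "pochhammer (s + 1) n = 0"
  then obtain k where "s + 1 = - of_nat k"
    by (auto simp: pochhammer_eq_0_iff)
  then have "s + of_nat (Suc k) = 0"
    by (simp add: eq_neg_iff_add_eq_0 add.assoc)
  with s_not_neg[of "Suc k"] show False
    by simp
qed

lemma scoef_diag: "scoef s n n = 1"
  by (simp add: scoef_def pochhammer_nz)

lemma scoef_Suc_left:
  assumes "m \<le> n"
  shows "scoef s (Suc n) m = (of_nat n + 1 + s) * (of_nat n + of_nat m + 1 + s)
           / ((of_nat n + 1) * (of_nat n + 1 - of_nat m)) * scoef s n m"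
proof -
  obtain k where n: "n = m + k"
    using assms le_Suc_ex by blast
  have [simp]: "(1 + of_nat k :: complex) \<noteq> 0" "(1 + (of_nat k + of_nat m) :: complex) \<noteq> 0"
    by (metis of_nat_Suc of_nat_neq_0, metis of_nat_Suc of_nat_neq_0 of_nat_add)
  have d: "Suc n - m = Suc k" "n - m = k"
    using n by auto
  show ?thesis
    using assms pochhammer_nz[of m] unfolding scoef_def d
    by (simp add: n pochhammer_Suc field_simps)
qed

text \<open>Multiplication by y^2 brings in the coefficient at index M - 1; with M = m + 1 this
  expresses it through the one at M.\<close>

lemma scoef_Suc_right:
  assumes "Suc m \<le> n"
  shows "of_nat (Suc m) * (of_nat n + of_nat (Suc m) + s) * (of_nat n + 1 - of_nat (Suc m)) * scoef s n m
     = (2 * of_nat (Suc m) + s) * (2 * of_nat (Suc m) + s - 1) * (of_nat (Suc m) + s) * scoef s n (Suc m)"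
proof -
  obtain k where n: "n = Suc m + k"
    using assms le_Suc_ex by blast
  define M :: complex where "M = of_nat m"
  define K :: complex where "K = of_nat k"
  have K: "1 + K \<noteq> 0"
    unfolding K_def by (metis of_nat_Suc of_nat_neq_0)
  have sM: "M + 1 + s \<noteq> 0"
    using s_not_neg[of "Suc m"] by (simp add: M_def algebra_simps)
  have d: "n - m = Suc k" "n - Suc m = k"
    using n by auto
  \<comment> \<open>Both sides are the Pochhammer symbol of length k + 2 at 2 M + s + 1, with the
    last factor split off on the left and the first two on the right.\<close>
  have p: "(2 * M + s + 2 + K) * pochhammer (2 * M + s + 1) (Suc k)
      = (2 * M + s + 1) * (2 * M + s + 2) * pochhammer (2 * M + s + 3) k"
  proof -
    have "(2 * M + s + 2 + K) * pochhammer (2 * M + s + 1) (Suc k) = pochhammer (2 * M + s + 1) (Suc (Suc k))"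
      by (simp add: pochhammer_Suc K_def algebra_simps)
    also have "\<dots> = (2 * M + s + 1) * ((2 * M + s + 2) * pochhammer (2 * M + s + 3) k)"
      by (simp only: pochhammer_rec) (simp add: algebra_simps)
    finally show ?thesis by simp
  qed
  define Q where "Q = pochhammer (2 * M + s + 1) (Suc k)"
  define R where "R = pochhammer (2 * M + s + 3) k"
  define B where "B = pochhammer (s + 1) n / fact n * fact m / pochhammer (s + 1) m / fact k"
  have l: "scoef s n m = B * Q / (1 + K)"
    using assms unfolding scoef_def d B_def Q_def
    by (simp add: M_def K_def field_simps)
  have r: "scoef s n (Suc m) = B * (M + 1) / (M + 1 + s) * R"
    using assms unfolding scoef_def d B_def R_def
    by (simp add: M_def pochhammer_Suc field_simps)
  have "of_nat (Suc m) * (of_nat n + of_nat (Suc m) + s) * (of_nat n + 1 - of_nat (Suc m)) * scoef s n m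
      = (M + 1) * B * ((2 * M + s + 2 + K) * Q)"
    unfolding l using K by (simp add: n M_def[symmetric] K_def[symmetric] field_simps)
  also have "\<dots> = (M + 1) * B * ((2 * M + s + 1) * (2 * M + s + 2) * R)"
    using p by (simp add: Q_def R_def)
  also have "\<dots> = (2 * of_nat (Suc m) + s) * (2 * of_nat (Suc m) + s - 1) * (of_nat (Suc m) + s) * scoef s n (Suc m)"
    using sM unfolding r by (simp add: M_def[symmetric] field_simps)
  finally show ?thesis .
qed

text \<open>By \<open>bas_rec\<close>, \<open>T\<close> is the coefficient of A_m in y^2 S_N, where
  N = n + 1; at m = 0 the truncated \<open>m - 1\<close> is harmless because of the factor
  \<open>M\<^sup>2\<close>. For m \<le> N every term is a rational multiple of
  \<open>scoef s (Suc n) m\<close>, so both claims become identities between rational functions of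
  N, M and s.\<close>

lemma coef_rec:
  fixes n m :: nat
  assumes "m \<le> Suc (Suc n)"
  defines "N \<equiv> of_nat (Suc n) :: complex" and "M \<equiv> of_nat m :: complex"
  defines "T \<equiv> (s + 2 * M + 1)\<^sup>2 * scoef s (Suc n) m + M\<^sup>2 * scoef s (Suc n) (m - 1)"
  shows "(N + 1)\<^sup>2 * scoef s (Suc (Suc n)) m
           = T + 2 * vcoef s (Suc n) m + (N + s)\<^sup>2 * scoef s n m" (is ?S)
    and "(N + 1) * vcoef s (Suc (Suc n)) m = (N + 1 + s) * (T + vcoef s (Suc n) m)" (is ?V)
proof -
  have nz: "N + s \<noteq> 0" "N + M + s \<noteq> 0" "N + 1 + M + s \<noteq> 0" "N \<noteq> 0" "N + 1 \<noteq> 0"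
    using s_not_neg[of "Suc n"] s_not_neg[of "Suc n + m"] s_not_neg[of "Suc (Suc n) + m"]
      of_nat_neq_0[of n, where ?'a = complex] of_nat_neq_0[of "Suc n", where ?'a = complex]
    by (simp_all add: N_def M_def algebra_simps)
  have "?S \<and> ?V"
  proof (cases "m = Suc (Suc n)")
    \<comment> \<open>At the top index \<open>scoef s (Suc n) m\<close> is 0 and cannot serve as
      reference; only diagonal entries, equal to 1, survive.\<close>
    case True
    have M: "M = N + 1"
      by (simp add: M_def N_def True)
    have c: "scoef s (Suc n) m = 0" "scoef s n m = 0" "scoef s (Suc n) (m - 1) = 1"
      "scoef s (Suc (Suc n)) m = 1"
      by (simp_all add: True scoef_diag scoef_eq_0)
    have "of_nat (Suc (Suc n)) = N + 1" "of_nat m = N + 1"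
      using M by (simp_all add: N_def M_def)
    then have v: "vcoef s (Suc n) m = 0" "vcoef s (Suc (Suc n)) m = (N + 1) * (N + 1 + s)"
      using nz(3) unfolding vcoef_def c M
      by (simp_all only: mult_2 diff_self mult_zero_left add_0_left mult_1 nonzero_mult_div_cancel_right not_False_eq_True)
    show ?thesis
      unfolding T_def c v M by (simp add: power2_eq_square)
  next
    case False
    then have mn: "m \<le> Suc n"
      using assms(1) by simp
    define u where "u = scoef s (Suc n) m"
    have g: "N + 1 - M \<noteq> 0"
    proof -
      have "N + 1 - M = of_nat (Suc (Suc n) - m)"
        using mn by (simp add: N_def M_def of_nat_diff)
      then show ?thesis
        using mn by (simp del: of_nat_diff)
    qed
    have u1: "scoef s (Suc (Suc n)) m = (N + 1 + s) * (N + 1 + M + s) / ((N + 1) * (N + 1 - M)) * u"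
      using scoef_Suc_left[OF mn] by (simp add: N_def M_def u_def algebra_simps)
    \<comment> \<open>The formula also covers m = N: there \<open>scoef s n m\<close> is 0 and so is
      the factor N - M.\<close>
    have u2: "(N + s)\<^sup>2 * scoef s n m = N * (N - M) * (N + s) / (N + M + s) * u"
    proof (cases "m \<le> n")
      case True
      have "N - M \<noteq> 0"
      proof -
        have "N - M = of_nat (Suc n - m)"
          using True by (simp add: N_def M_def of_nat_diff)
        then show ?thesis
          using True by (simp del: of_nat_diff)
      qed
      moreover have "u = (N + s) * (N + M + s) / (N * (N - M)) * scoef s n m"
        using scoef_Suc_left[OF True] by (simp add: N_def M_def u_def algebra_simps)
      ultimately show ?thesis
        using nz by (simp add: power2_eq_square)
    next
      case False
      then have "N = M"
        using mn by (simp only: N_def M_def le_Suc_eq simp_thms)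
      then show ?thesis
        using False by (simp add: scoef_eq_0)
    qed
    have u3: "M\<^sup>2 * scoef s (Suc n) (m - 1)
        = M * (2 * M + s) * (2 * M + s - 1) * (M + s) / ((N + M + s) * (N + 1 - M)) * u"
    proof (cases m)
      case 0
      then show ?thesis by (simp add: M_def)
    next
      case (Suc j)
      have "M * (N + M + s) * (N + 1 - M) * scoef s (Suc n) j = (2 * M + s) * (2 * M + s - 1) * (M + s) * u"
        using scoef_Suc_right[of j "Suc n"] mn unfolding Suc N_def M_def u_def by simp
      then have "M\<^sup>2 * scoef s (Suc n) j * ((N + M + s) * (N + 1 - M))
          = M * ((2 * M + s) * (2 * M + s - 1) * (M + s) * u)"
        by (metis (no_types, lifting) mult.assoc mult.commute power2_eq_square)
      then have "M\<^sup>2 * scoef s (Suc n) j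
          = M * ((2 * M + s) * (2 * M + s - 1) * (M + s) * u) / ((N + M + s) * (N + 1 - M))"
        using nz g by (simp only: eq_divide_eq mult_eq_0_iff simp_thms if_True if_False)
      then show ?thesis
        by (simp add: Suc mult.assoc)
    qed
    have v: "vcoef s (Suc n) m = u * (N - M + N * (N + s) * (2 * M + s) / (N + M + s))"
      by (simp add: vcoef_def u_def N_def M_def)
    have v1: "vcoef s (Suc (Suc n)) m = (N + 1 + s) * (N + 1 + M + s) / ((N + 1) * (N + 1 - M)) * u *
        (N + 1 - M + (N + 1) * (N + 1 + s) * (2 * M + s) / (N + 1 + M + s))"
      unfolding vcoef_def u1 by (simp add: N_def M_def algebra_simps)
    have "?S"
      unfolding T_def u_def[symmetric] u1 u2 u3 v
      using nz g by (simp add: divide_simps) algebra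
    moreover have "?V"
      unfolding T_def u_def[symmetric] u3 v v1
      using nz g by (simp add: divide_simps) algebra
    ultimately show ?thesis ..
  qed
  then show ?S and ?V by auto
qed

section \<open>Expansion of the squares by induction\<close>

text \<open>\<open>bas_rec\<close> spreads term m over A_m and A_(m+1); the sum is then regrouped by
  basis element. The condition \<open>c N = 0\<close> keeps A_(N+1) out.\<close>

lemma sum_bas_mult:
  assumes "c N = 0"
  shows "(2 * x + 1)\<^sup>2 * (\<Sum>m\<le>N. c m * bas r x m)
     = (\<Sum>m\<le>N. ((2 * r + 2 * of_nat m + 1)\<^sup>2 * c m + (of_nat m)\<^sup>2 * c (m - 1)) * bas r x m)"
proof -
  have "(2 * x + 1)\<^sup>2 * (\<Sum>m\<le>N. c m * bas r x m)
      = (\<Sum>m\<le>N. c m * ((2 * x + 1)\<^sup>2 * bas r x m))"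
    unfolding sum_distrib_left by (rule sum.cong) (simp_all only: mult_ac)
  also have "\<dots> = (\<Sum>m\<le>N. (2 * r + 2 * of_nat m + 1)\<^sup>2 * c m * bas r x m)
      + (\<Sum>m\<le>N. (of_nat (Suc m))\<^sup>2 * c m * bas r x (Suc m))"
    unfolding bas_rec sum.distrib[symmetric]
    by (rule sum.cong) (simp_all only: distrib_left mult_ac)
  also have "(\<Sum>m\<le>N. (of_nat (Suc m))\<^sup>2 * c m * bas r x (Suc m))
      = (\<Sum>m<N. (of_nat (Suc m))\<^sup>2 * c m * bas r x (Suc m))"
    using assms by (simp add: lessThan_Suc_atMost[symmetric] del: of_nat_Suc)
  \<comment> \<open>After the index shift the new term m = 0 vanishes because of its factor
    m^2.\<close>
  also have "\<dots> = (\<Sum>m\<le>N. (of_nat m)\<^sup>2 * c (m - 1) * bas r x m)"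
    by (simp add: sum.atMost_shift del: of_nat_Suc)
  finally show ?thesis
    by (simp add: sum.distrib distrib_right)
qed

lemma sum_scoef_extend:
  "n \<le> N \<Longrightarrow> (\<Sum>m\<le>N. scoef s n m * b m) = (\<Sum>m\<le>n. scoef s n m * b m)"
  by (rule sum.mono_neutral_right) (auto simp: scoef_eq_0)

lemma sum_vcoef_extend:
  "n \<le> N \<Longrightarrow> (\<Sum>m\<le>N. vcoef s n m * b m) = (\<Sum>m\<le>n. vcoef s n m * b m)"
  by (rule sum.mono_neutral_right) (auto simp: vcoef_def scoef_eq_0)

text \<open>The recurrence has order two, so the induction carries two consecutive squares and the
  mixed product that links them.\<close>

lemma dval_square_expansion:
  assumes s: "s = 2 * r"
  shows "(dval r x n)\<^sup>2 = (\<Sum>m\<le>n. scoef s n m * bas r x m)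
    \<and> (dval r x (Suc n))\<^sup>2 = (\<Sum>m\<le>Suc n. scoef s (Suc n) m * bas r x m)
    \<and> (of_nat (Suc n) + s) * (2 * x + 1) * dval r x (Suc n) * dval r x n
        = (\<Sum>m\<le>Suc n. vcoef s (Suc n) m * bas r x m)"
proof (induction n)
  case 0
  have nz: "s + 1 \<noteq> 0" "s + 2 \<noteq> 0" "1 + s \<noteq> 0"
    using s_not_neg[of 1] s_not_neg[of 2] by (simp_all add: add.commute)
  have b0: "bas r x 0 = 1"
    by (simp add: bas_def)
  \<comment> \<open>This gives y^2 = A_1 + (s + 1)^2 A_0, from which d_1^2 = y^2 and V_1 = (s + 1)
    y^2 are read off.\<close>
  have b1: "bas r x (Suc 0) = (2 * x + 1)\<^sup>2 - (s + 1)\<^sup>2"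
    using bas_rec[of x r 0] by (simp add: b0 s)
  have c: "scoef s 0 0 = 1" "scoef s (Suc 0) (Suc 0) = 1"
    by (simp_all only: scoef_diag)
  have c10: "scoef s (Suc 0) 0 = (s + 1)\<^sup>2"
    by (simp add: scoef_def power2_eq_square)
  have v: "vcoef s (Suc 0) 0 = (s + 1) ^ 3" "vcoef s (Suc 0) (Suc 0) = s + 1"
    using nz unfolding vcoef_def c10 c
    by (simp_all add: field_simps power2_eq_square power3_eq_cube)
  show ?case
    by (simp add: dval_0 dval_1 b0 b1 c c10 v power3_eq_cube power2_eq_square algebra_simps)
next
  case (Suc n)
  define N :: complex where "N = of_nat (Suc n)"
  define y where "y = 2 * x + 1"
  define d0 d1 d2 where "d0 = dval r x n" and "d1 = dval r x (Suc n)" and "d2 = dval r x (Suc (Suc n))"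
  let ?T = "\<lambda>m. (s + 2 * of_nat m + 1)\<^sup>2 * scoef s (Suc n) m + (of_nat m)\<^sup>2 * scoef s (Suc n) (m - 1)"
  let ?M = "Suc (Suc n)"
  have N1: "N + 1 \<noteq> 0"
    using of_nat_neq_0[of "Suc n", where ?'a = complex] by (simp add: N_def add.commute)
  have rec: "(N + 1) * d2 = y * d1 + (N + s) * d0"
    using dval_rec[of n r x] by (simp add: N_def d0_def d1_def d2_def y_def s algebra_simps)
  \<comment> \<open>Zero coefficients pad all three sums to the range up to n + 2, so that they
    combine termwise; for d_(n+1)^2 the last one is 0, as \<open>sum_bas_mult\<close>
    requires.\<close>
  have S0: "d0\<^sup>2 = (\<Sum>m\<le>?M. scoef s n m * bas r x m)"
    and S1: "d1\<^sup>2 = (\<Sum>m\<le>?M. scoef s (Suc n) m * bas r x m)"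
    and V1: "(N + s) * y * d1 * d0 = (\<Sum>m\<le>?M. vcoef s (Suc n) m * bas r x m)"
    using Suc.IH sum_scoef_extend[of n ?M "bas r x"] sum_scoef_extend[of "Suc n" ?M "bas r x"]
      sum_vcoef_extend[of "Suc n" ?M "bas r x"]
    by (simp_all only: d0_def d1_def N_def y_def le_SucI order_refl)
  have T: "y\<^sup>2 * d1\<^sup>2 = (\<Sum>m\<le>?M. ?T m * bas r x m)"
    unfolding S1 y_def s by (rule sum_bas_mult) (simp add: scoef_eq_0)
  have "(N + 1)\<^sup>2 * d2\<^sup>2 = y\<^sup>2 * d1\<^sup>2 + 2 * ((N + s) * y * d1 * d0) + (N + s)\<^sup>2 * d0\<^sup>2"
    unfolding power_mult_distrib[symmetric] rec by (simp add: power2_eq_square algebra_simps)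
  also have "\<dots> = (\<Sum>m\<le>?M. (?T m + 2 * vcoef s (Suc n) m + (N + s)\<^sup>2 * scoef s n m) * bas r x m)"
    unfolding T V1 S0 by (simp only: sum_distrib_left sum.distrib distrib_right mult.assoc)
  also have "\<dots> = (\<Sum>m\<le>?M. (N + 1)\<^sup>2 * (scoef s ?M m * bas r x m))"
    by (rule sum.cong) (simp_all only: coef_rec(1)[symmetric] N_def mult.assoc[symmetric] atMost_iff)
  finally have S2: "d2\<^sup>2 = (\<Sum>m\<le>?M. scoef s ?M m * bas r x m)"
    using N1 by (simp add: sum_distrib_left[symmetric])
  \<comment> \<open>The recurrence times y d_(n+1) yields y^2 d_(n+1)^2 plus the previous mixed
    product.\<close>
  have "(N + 1) * ((N + 1 + s) * y * d2 * d1) = (N + 1 + s) * (y * d1 * ((N + 1) * d2))"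
    by (simp only: mult_ac)
  also have "\<dots> = (N + 1 + s) * (y\<^sup>2 * d1\<^sup>2 + (N + s) * y * d1 * d0)"
    unfolding rec by (simp add: power2_eq_square algebra_simps)
  also have "\<dots> = (\<Sum>m\<le>?M. ((N + 1 + s) * (?T m + vcoef s (Suc n) m)) * bas r x m)"
    unfolding T V1 by (simp only: sum_distrib_left sum.distrib distrib_left distrib_right mult.assoc)
  also have "\<dots> = (\<Sum>m\<le>?M. (N + 1) * (vcoef s ?M m * bas r x m))"
    by (rule sum.cong) (simp_all only: coef_rec(2)[symmetric] N_def mult.assoc[symmetric] atMost_iff)
  finally have V2: "(N + 1 + s) * y * d2 * d1 = (\<Sum>m\<le>?M. vcoef s ?M m * bas r x m)"
    using N1 by (simp only: sum_distrib_left[symmetric] mult_cancel_left) simp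
  have N2: "of_nat ?M = N + 1"
    by (simp add: N_def)
  from Suc.IH S2 V2 show ?case
    unfolding N2 d0_def d1_def d2_def y_def by blast
qed

end

section \<open>Return to binomial coefficients and to polynomials\<close>

lemma scoef_eq_gbinomial:
  assumes "m \<le> n"
  shows "scoef s n m = ((of_nat n + s) gchoose n) *
    (((of_nat n + s + of_nat m) gchoose (n - m)) / ((of_nat m + s) gchoose m))"
  using assms by (simp add: scoef_def gbinomial_pochhammer' of_nat_diff algebra_simps)

theorem theorem2p6:
  fixes r :: complex and n :: nat
  assumes "r \<notin> {- (of_nat k / 2) | k :: nat. k \<ge> 1}"
  shows "(d_poly r n)\<^sup>2 =
    smult ((of_nat n + 2 * r) gchoose n)
      (\<Sum>m=0..n.
         smult (((of_nat n + 2 * r + of_nat m) gchoose (n - m)) /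
                ((of_nat m + 2 * r) gchoose m) * 4 ^ m)
           ((([:0, 1:] - [:r:]) pchoose m) * (([:0, 1:] + [:r:] + of_nat m) pchoose m)))"
    (is "_ = ?R")
proof -
  have nz: "2 * r + of_nat k \<noteq> 0" if "k \<ge> 1" for k
  proof
    assume "2 * r + of_nat k = 0"
    then have "2 * r = - of_nat k"
      by (simp add: eq_neg_iff_add_eq_0)
    then have "r = - (of_nat k / 2)"
      by (metis divide_minus_left nonzero_mult_div_cancel_left zero_neq_numeral)
    with assms that show False
      by blast
  qed
  \<comment> \<open>A complex polynomial is determined by its values, so the identity is checked at
    each point x.\<close>
  have "poly ((d_poly r n)\<^sup>2) x = poly ?R x" for x
  proof -
    have "poly ((d_poly r n)\<^sup>2) x = (\<Sum>m\<le>n. scoef (2 * r) n m * bas r x m)"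
      using dval_square_expansion[OF nz refl, of x n] by (simp add: poly_d_poly)
    also have "\<dots> = poly ?R x"
      unfolding poly_smult poly_sum sum_distrib_left atMost_atLeast0
      by (rule sum.cong)
        (simp_all add: scoef_eq_gbinomial bas_def poly_pbinomial of_nat_poly algebra_simps)
    finally show ?thesis .
  qed
  then show ?thesis
    by (intro iffD1[OF poly_eq_poly_eq_iff] ext)
qed

end
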